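(* Let $X,Y$ be locally convex spaces, let $\mathcal{K}\subseteq Y$ be a closed convex cone such that $\mathcal{K}^+$ is $w^\ast$-compactly generated by $\mathcal{B}$, and let $\Phi\in\Gamma_h(X,Y,\mathcal{B})$ and $\varphi\in\Gamma_h(X)$ for some function $h\in\Gamma_0(X)$. Let $\bar x$ be a feasible point of the problem $\min\varphi(x)$ s.t. $\Phi(x)\in-\mathcal{K}$ such that, for all $\eta\ge0$ small enough, $$\partial_\eta h(\bar x)\subseteq\bigcup\Big[\alpha_1\,\partial_{\eta_1}(\varphi+h)(\bar x)+\alpha_2\,\partial_{\eta_2}\big(\langle\lambda^\ast,\Phi\rangle+h\big)(\bar x)\Big],$$ where the union is taken over all $\eta_1,\eta_2\ge0$, $(\alpha_1,\alpha_2)\in\Delta_2$ and $\lambda^\ast\in\mathcal{B}$ such that $\alpha_1\eta_1+\alpha_2(\eta_2-\langle\lambda^\ast,\Phi(\bar x)\rangle)=\eta$. Additionally, suppose that $h$ is continuous at $\bar x$ and that the following qualification holds: $$\partial h(\bar x)\cap\bigcup\big[\partial\big(\langle\lambda^\ast,\Phi\rangle+h\big)(\bar x):\lambda^\ast\in\mathcal{B},\ \langle\lambda^\ast,\Phi(\bar x)\rangle=0\big]=\emptyset.$$ Then $\bar x$ is a local solution of the problem $\min\varphi(x)$ s.t. $\Phi(x)\in-\mathcal{K}$.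
   Context: $X,Y$ are real Hausdorff locally convex spaces with topological duals $X^\ast,Y^\ast$; $Y$ is enlarged by an extra element $\infty_Y$. For $F:X\to Y\cup\{\infty_Y\}$, $\operatorname{dom}F=\{x: F(x)\in Y\}$, and for $y^\ast\in Y^\ast$ the function $\langle y^\ast,F\rangle:X\to\mathbb{R}\cup\{+\infty\}$ equals $\langle y^\ast,F(x)\rangle$ if $x\in\operatorname{dom}F$ and $+\infty$ otherwise. $\Gamma_0(X)$ is the set of proper convex lower semicontinuous functions $X\to\mathbb{R}\cup\{+\infty\}$. For $h\in\Gamma_0(X)$: $\Gamma_h(X)$ is the set of $f:X\to\mathbb{R}\cup\{+\infty\}$ with $\operatorname{dom}f\subseteq\operatorname{dom}h$ and $f+h\in\Gamma_0(X)$; for nonempty $B\subseteq Y^\ast$, $\Gamma_h(X,Y,B)$ is the set of $F:X\to Y\cup\{\infty_Y\}$ with $\operatorname{dom}F\subseteq\operatorname{dom}h$ and $\langle\lambda^\ast,F\rangle+h\in\Gamma_0(X)$ for all $\lambda^\ast\in B$. The positive polar cone is $\mathcal{K}^+=\{y^\ast\in Y^\ast:\langle y^\ast,y\rangle\ge0\ \forall y\in\mathcal{K}\}$. A closed convex cone $\Theta\subseteq Y^\ast$ is $w^\ast$-compactly generated by $\mathcal{B}$ if $\mathcal{B}\subseteq Y^\ast$ is a weak$^\ast$-compact convex set with $\Theta=\operatorname{cl}^\ast\operatorname{cone}(\mathcal{B})$, where $\operatorname{cl}^\ast$ is the weak$^\ast$-closure and $\operatorname{cone}(\mathcal B)$ the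 convex cone generated by $\mathcal{B}$. For $\epsilon\ge0$ and $f:X\to\overline{\mathbb R}$, $\partial_\epsilon f(x)=\{x^\ast\in X^\ast:\langle x^\ast,y-x\rangle\le f(y)-f(x)+\epsilon\ \forall y\in X\}$ if $f(x)\in\mathbb{R}$, and $\partial_\epsilon f(x)=\emptyset$ otherwise; $\partial f=\partial_0f$. $\Delta_2=\{(\alpha_1,\alpha_2)\in[0,1]^2:\alpha_1+\alpha_2=1\}$. Set conventions: $A+\emptyset=\emptyset+A=\emptyset$ and $0\,\emptyset=\{0\}$. A feasible point is an $x$ with $\Phi(x)\in-\mathcal{K}$; a local solution is a feasible $\bar x$ having a neighbourhood $U$ with $\varphi(\bar x)\le\varphi(x)$ for all feasible $x\in U$. *)

theory Defs
  imports "HOL-Analysis.Analysis"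
begin

text \<open>Real Hausdorff locally convex topological vector spaces.\<close>

class lc_space = real_vector + topological_ab_group_add + t2_space +
  assumes tendsto_scaleR_nhds_Pair:
    "((\<lambda>p. fst p *\<^sub>R snd p) \<longlongrightarrow> r *\<^sub>R a) (nhds (r::real) \<times>\<^sub>F nhds a)"
  and locally_convex_raw:
    "open U \<Longrightarrow> a \<in> U \<Longrightarrow>
      \<exists>V. open V \<and> a \<in> V \<and> V \<subseteq> U \<and>
        (\<forall>x\<in>V. \<forall>y\<in>V. \<forall>u\<ge>0. \<forall>v\<ge>0. u + v = 1 \<longrightarrow> u *\<^sub>R x + v *\<^sub>R y \<in> V)"

lemma locally_convex:
  fixes a :: "'a::lc_space"
  assumes "open U" "a \<in> U"
  shows "\<exists>V. open V \<and> convex V \<and> a \<in> V \<and> V \<subseteq> U"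
  using locally_convex_raw[OF assms] unfolding convex_def by blast

instance real_normed_vector \<subseteq> lc_space
proof
  fix r :: real and a :: 'a
  have 1: "(fst \<longlongrightarrow> r) (nhds r \<times>\<^sub>F nhds a)"
    by (rule filterlim_fst)
  have 2: "(snd \<longlongrightarrow> a) (nhds r \<times>\<^sub>F nhds a)"
    by (rule filterlim_snd)
  show "((\<lambda>p. fst p *\<^sub>R snd p) \<longlongrightarrow> r *\<^sub>R a) (nhds r \<times>\<^sub>F nhds a)"
    by (rule tendsto_scaleR[OF 1 2])
next
  fix U :: "'a set" and a :: 'a
  assume "open U" "a \<in> U"
  then obtain e where "e > 0" "ball a e \<subseteq> U"
    using open_contains_ball by blast
  moreover have "convex (ball a e)"
    by simp
  ultimately show "\<exists>V. open V \<and> a \<in> V \<and> V \<subseteq> U \<and>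
      (\<forall>x\<in>V. \<forall>y\<in>V. \<forall>u\<ge>0. \<forall>v\<ge>0. u + v = 1 \<longrightarrow> u *\<^sub>R x + v *\<^sub>R y \<in> V)"
    unfolding convex_def by (intro exI[of _ "ball a e"]) auto
qed

text \<open>The topological dual, as a real vector space.\<close>

typedef (overloaded) 'a dual =
    "{f :: 'a::lc_space \<Rightarrow> real. linear f \<and> continuous_on UNIV f}"
  morphisms dual_apply Dual
proof
  show "(\<lambda>_. 0) \<in> {f :: 'a \<Rightarrow> real. linear f \<and> continuous_on UNIV f}"
    by (auto intro!: linearI)
qed

lemma linear_dual_apply: "linear (dual_apply f)"
  and continuous_on_dual_apply: "continuous_on UNIV (dual_apply f)"
  using dual_apply[of f] by auto

lemma dual_eqI: "(\<And>x. dual_apply f x = dual_apply g x) \<Longrightarrow> f = g"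
  using dual_apply_inject by blast

instantiation dual :: (lc_space) real_vector
begin

definition "0 = Dual (\<lambda>_. 0)"
definition "f + g = Dual (\<lambda>x. dual_apply f x + dual_apply g x)"
definition "- f = Dual (\<lambda>x. - dual_apply f x)"
definition "f - g = Dual (\<lambda>x. dual_apply f x - dual_apply g x)" for f g :: "'a dual"
definition "r *\<^sub>R f = Dual (\<lambda>x. r * dual_apply f x)"

lemma dual_apply_zero [simp]: "dual_apply 0 x = 0"
  unfolding zero_dual_def by (subst Dual_inverse) (auto intro!: linearI)

lemma dual_apply_add [simp]: "dual_apply (f + g) x = dual_apply f x + dual_apply g x"
  unfolding plus_dual_def
  by (subst Dual_inverse)
     (auto intro!: linear_compose_add linear_dual_apply continuous_intros continuous_on_dual_apply)

lemma dual_apply_uminus [simp]: "dual_apply (- f) x = - dual_apply f x"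
  unfolding uminus_dual_def
  by (subst Dual_inverse)
     (auto intro!: linear_compose_neg linear_dual_apply continuous_intros continuous_on_dual_apply)

lemma dual_apply_diff [simp]: "dual_apply (f - g) x = dual_apply f x - dual_apply g x"
  unfolding minus_dual_def
  by (subst Dual_inverse)
     (auto intro!: linear_compose_sub linear_dual_apply continuous_intros continuous_on_dual_apply)

lemma dual_apply_scaleR [simp]: "dual_apply (r *\<^sub>R f) x = r * dual_apply f x"
proof -
  have "linear (\<lambda>x. r *\<^sub>R dual_apply f x)"
    by (intro linear_compose_scale_right linear_dual_apply)
  then show ?thesis
    unfolding scaleR_dual_def
    by (subst Dual_inverse) (auto intro!: continuous_intros continuous_on_dual_apply)
qed

instance
  by standard (auto intro!: dual_eqI simp: algebra_simps)

end

text \<open>The dual carries the weak-star topology: the initial topology for the evaluation maps,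
  that is, the trace of the product topology on \<^typ>\<open>'a \<Rightarrow> real\<close>. So \<^const>\<open>compact\<close> and
  \<^const>\<open>closure\<close> on the dual always refer to the weak-star topology.\<close>

instantiation dual :: (lc_space) topological_space
begin

definition open_dual_def:
  "open (U :: 'a dual set) \<longleftrightarrow> (\<exists>V. open V \<and> U = dual_apply -` V)"

instance
proof
  show "open (UNIV :: 'a dual set)"
    unfolding open_dual_def by (intro exI[of _ UNIV]) auto
next
  fix S T :: "'a dual set"
  assume "open S" "open T"
  then obtain V W where "open V" "S = dual_apply -` V" "open W" "T = dual_apply -` W"
    unfolding open_dual_def by blast
  then show "open (S \<inter> T)"
    unfolding open_dual_def by (intro exI[of _ "V \<inter> W"]) auto
next
  fix \<U> :: "'a dual set set"
  assume "\<forall>S\<in>\<U>. open S"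
  then obtain V where "\<And>S. S \<in> \<U> \<Longrightarrow> open (V S) \<and> S = dual_apply -` V S"
    unfolding open_dual_def by metis
  then show "open (\<Union>\<U>)"
    unfolding open_dual_def by (intro exI[of _ "\<Union>(V ` \<U>)"]) blast
qed

end

definition positive_polar :: "'a::lc_space set \<Rightarrow> 'a dual set" where
  "positive_polar K = {l. \<forall>y\<in>K. 0 \<le> dual_apply l y}"

definition wstar_compactly_generated :: "'a::lc_space dual set \<Rightarrow> 'a dual set \<Rightarrow> bool" where
  "wstar_compactly_generated \<Theta> B \<longleftrightarrow>
     compact B \<and> convex B \<and> \<Theta> = closure (convex_cone hull B)"

text \<open>A function into \<open>\<real> \<union> {+\<infinity>}\<close> is an \<^typ>\<open>ereal\<close>-valued function that never takes the
  value \<open>-\<infinity>\<close>. In \<^typ>\<open>ereal\<close> we have \<open>0 * \<infinity> = 0\<close>, so the convexity inequality is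
  trivial for the weights 0 and 1.\<close>

definition edom :: "('a \<Rightarrow> ereal) \<Rightarrow> 'a set" where
  "edom f = {x. f x \<noteq> \<infinity>}"

definition convex_fun :: "('a::real_vector \<Rightarrow> ereal) \<Rightarrow> bool" where
  "convex_fun f \<longleftrightarrow>
     (\<forall>x y. \<forall>u\<ge>0. \<forall>v\<ge>0. u + v = 1 \<longrightarrow>
        f (u *\<^sub>R x + v *\<^sub>R y) \<le> ereal u * f x + ereal v * f y)"

definition lower_semicontinuous :: "('a::topological_space \<Rightarrow> ereal) \<Rightarrow> bool" where
  "lower_semicontinuous f \<longleftrightarrow> (\<forall>x. \<forall>c<f x. \<forall>\<^sub>F y in nhds x. c < f y)"

definition Gamma0 :: "('a::lc_space \<Rightarrow> ereal) set" where
  "Gamma0 = {f. (\<forall>x. f x \<noteq> -\<infinity>) \<and> edom f \<noteq> {} \<and> convex_fun f \<and> lower_semicontinuous f}"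

definition Gamma_rel :: "('a::lc_space \<Rightarrow> ereal) \<Rightarrow> ('a \<Rightarrow> ereal) set" where
  "Gamma_rel h = {f. (\<forall>x. f x \<noteq> -\<infinity>) \<and> edom f \<subseteq> edom h \<and> (\<lambda>x. f x + h x) \<in> Gamma0}"

text \<open>Maps into \<open>Y \<union> {\<infinity>\<^sub>Y}\<close> are option-valued, with \<^const>\<open>None\<close> for the extra element.\<close>

definition vdom :: "('a \<Rightarrow> 'b option) \<Rightarrow> 'a set" where
  "vdom F = {x. F x \<noteq> None}"

definition scalarize :: "'b::lc_space dual \<Rightarrow> ('a \<Rightarrow> 'b option) \<Rightarrow> 'a \<Rightarrow> ereal" where
  "scalarize l F x = (case F x of Some y \<Rightarrow> ereal (dual_apply l y) | None \<Rightarrow> \<infinity>)"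

definition Gamma_vec ::
    "('a::lc_space \<Rightarrow> ereal) \<Rightarrow> 'b::lc_space dual set \<Rightarrow> ('a \<Rightarrow> 'b option) set" where
  "Gamma_vec h B =
     {F. vdom F \<subseteq> edom h \<and> (\<forall>l\<in>B. (\<lambda>x. scalarize l F x + h x) \<in> Gamma0)}"

definition eps_subdiff :: "real \<Rightarrow> ('a::lc_space \<Rightarrow> ereal) \<Rightarrow> 'a \<Rightarrow> 'a dual set" where
  "eps_subdiff \<epsilon> f x =
     (if \<bar>f x\<bar> = \<infinity> then {}
      else {l. \<forall>y. ereal (dual_apply l (y - x)) \<le> f y - f x + ereal \<epsilon>})"

abbreviation subdiff :: "('a::lc_space \<Rightarrow> ereal) \<Rightarrow> 'a \<Rightarrow> 'a dual set" where
  "subdiff f x \<equiv> eps_subdiff 0 f x"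

definition Delta2 :: "(real \<times> real) set" where
  "Delta2 = {(\<alpha>\<^sub>1, \<alpha>\<^sub>2). \<alpha>\<^sub>1 \<in> {0..1} \<and> \<alpha>\<^sub>2 \<in> {0..1} \<and> \<alpha>\<^sub>1 + \<alpha>\<^sub>2 = 1}"

text \<open>Multiples of sets follow the convention \<open>0 \<emptyset> = {0}\<close>. Minkowski sums are those of
  \<^theory>\<open>HOL-Library.Set_Algebras\<close>, for which a sum with an empty summand is empty.\<close>

definition set_scale :: "real \<Rightarrow> 'a::real_vector set \<Rightarrow> 'a set" where
  "set_scale r A = (if r = 0 \<and> A = {} then {0} else (\<lambda>x. r *\<^sub>R x) ` A)"

definition feasible :: "('a \<Rightarrow> 'b::lc_space option) \<Rightarrow> 'b set \<Rightarrow> 'a \<Rightarrow> bool" where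
  "feasible \<Phi> K x \<longleftrightarrow> \<Phi> x \<in> Some ` uminus ` K"

definition local_solution ::
    "('a::lc_space \<Rightarrow> ereal) \<Rightarrow> ('a \<Rightarrow> 'b::lc_space option) \<Rightarrow> 'b set \<Rightarrow> 'a \<Rightarrow> bool" where
  "local_solution \<phi> \<Phi> K x \<longleftrightarrow>
     feasible \<Phi> K x \<and>
     (\<exists>U. open U \<and> x \<in> U \<and> (\<forall>y\<in>U. feasible \<Phi> K y \<longrightarrow> \<phi> x \<le> \<phi> y))"

end

theory Submission
  imports Defs
begin

text \<open>Fix a feasible point \<open>x\<close> close to \<open>xbar\<close>. As \<open>h\<close> is convex and bounded above near \<open>xbar\<close>, the
  Hahn-Banach theorem supplies a subgradient \<open>s\<close> of \<open>h\<close> at \<open>x\<close> (\<open>subdiff_nonempty\<close>). It is also an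
  \<open>\<eta>\<close>-subgradient at \<open>xbar\<close> with \<open>\<eta> = h xbar - h x + \<langle>s, x - xbar\<rangle>\<close>, and
  \<open>\<eta> \<le> h xbar - 2 h x + h (2 x - xbar)\<close> is small by continuity of \<open>h\<close> at \<open>xbar\<close>. The inclusion
  therefore splits \<open>s\<close> into \<open>\<alpha>\<^sub>1\<close> and \<open>\<alpha>\<^sub>2\<close> parts with a multiplier \<open>l \<in> B\<close>. When their
  subgradient inequalities are tested at this same \<open>x\<close>, the choice of \<open>\<eta>\<close> cancels all terms
  in \<open>h\<close>, and what remains is
  \<open>0 \<le> \<alpha>\<^sub>1 (\<phi> x - \<phi> xbar) + \<alpha>\<^sub>2 \<langle>l, \<Phi>(x)\<rangle>\<close>. The last term is at most 0 because
  \<open>x\<close> is feasible and \<open>B\<close> lies in the positive polar cone, so \<open>\<alpha>\<^sub>1 > 0\<close> gives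
  \<open>\<phi> xbar \<le> \<phi> x\<close>.

  If \<open>\<alpha>\<^sub>1 = 0\<close>, the same computation shows that \<open>\<langle>l, \<Phi>(x)\<rangle> = 0\<close> and that \<open>s\<close> is a common
  subgradient of \<open>h\<close> and \<open>\<langle>l, \<Phi>\<rangle> + h\<close> at \<open>x\<close>. The qualification forbids this at \<open>xbar\<close>; a
  compactness argument forbids it at all nearby points (\<open>limit_of_common_subgradients\<close>). By the
  Banach-Alaoglu theorem and the weak-star compactness of \<open>B\<close>, such pairs \<open>(s, l)\<close> at points tending
  to \<open>xbar\<close> would have a limit that violates the qualification at \<open>xbar\<close>.\<close>

section \<open>Continuous linear functionals and the weak-star topology\<close>

lemma tendsto_scaleR_lc:
  fixes g :: "'i \<Rightarrow> 'a::lc_space"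
  assumes "(f \<longlongrightarrow> r) F" "(g \<longlongrightarrow> a) F"
  shows "((\<lambda>i. f i *\<^sub>R g i) \<longlongrightarrow> r *\<^sub>R a) F"
  using filterlim_compose[OF tendsto_scaleR_nhds_Pair[of r a] filterlim_Pair[OF assms]]
  by simp

text \<open>This is how functionals constructed algebraically become elements of the dual. Scaling the
  argument by a large factor turns the one-sided bound near 0 into an arbitrarily small two-sided
  one; linearity moves continuity from 0 to every point.\<close>

lemma linear_bounded_above_imp_continuous:
  fixes l :: "'a::lc_space \<Rightarrow> real"
  assumes l: "linear l" and bd: "\<forall>\<^sub>F d in nhds 0. l d \<le> M"
  shows "continuous_on UNIV l"
proof -
  have M: "0 \<le> M"
    using eventually_nhds_x_imp_x[OF bd] linear_0[OF l] by simp
  have small: "\<forall>\<^sub>F d in nhds 0. \<bar>l d\<bar> < e" if "e > 0" for e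
  proof -
    \<comment> \<open>Any factor above \<open>M / e\<close> works; \<open>M + 1\<close> keeps it positive when \<open>M = 0\<close>.\<close>
    define c where "c = (M + 1) / e"
    have c: "c > 0" using M that by (simp add: c_def)
    have sc: "\<forall>\<^sub>F d in nhds 0. l (s *\<^sub>R d) \<le> M" for s
    proof -
      have "((\<lambda>d::'a. s *\<^sub>R d) \<longlongrightarrow> s *\<^sub>R 0) (nhds 0)"
        by (intro tendsto_scaleR_lc tendsto_const filterlim_ident)
      then have "((\<lambda>d::'a. s *\<^sub>R d) \<longlongrightarrow> 0) (nhds 0)" by simp
      with bd show ?thesis by (rule eventually_compose_filterlim)
    qed
    show ?thesis
      using sc[of c] sc[of "- c"]
    proof eventually_elim
      case (elim d)
      then have "c * \<bar>l d\<bar> \<le> M"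
        using c by (simp add: linear_scale[OF l] linear_neg[OF l] abs_if)
      also have "M < c * e" using that by (simp add: c_def)
      finally show ?case using c by simp
    qed
  qed
  have "(l \<longlongrightarrow> l a) (nhds a)" for a
  proof (rule tendstoI)
    fix e :: real assume "e > 0"
    have "((\<lambda>y. y - a) \<longlongrightarrow> a - a) (nhds a)"
      by (intro tendsto_diff tendsto_const filterlim_ident)
    then have "((\<lambda>y. y - a) \<longlongrightarrow> 0) (nhds a)" by simp
    with small[OF \<open>e > 0\<close>] have "\<forall>\<^sub>F y in nhds a. \<bar>l (y - a)\<bar> < e"
      by (rule eventually_compose_filterlim)
    then show "\<forall>\<^sub>F y in nhds a. dist (l y) (l a) < e"
      by (simp add: linear_diff[OF l] dist_real_def)
  qed
  then show ?thesis
    by (simp add: continuous_on_eq_continuous_at continuous_at tendsto_at_iff_tendsto_nhds)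
qed

lemma continuous_on_dual_evaluation: "continuous_on UNIV (\<lambda>l. dual_apply l x)"
proof -
  have "open ((\<lambda>l. dual_apply l x) -` S)" if "open S" for S
  proof -
    have "continuous_on UNIV (\<lambda>f::'a \<Rightarrow> real. f x)"
      by (rule continuous_on_product_coordinates)
    then have "open ((\<lambda>f::'a \<Rightarrow> real. f x) -` S)"
      using that by (simp add: open_vimage)
    then show ?thesis
      unfolding open_dual_def by (intro exI[of _ "(\<lambda>f. f x) -` S"]) auto
  qed
  then show ?thesis
    by (simp add: continuous_on_open_vimage)
qed

lemma tendsto_dual_evaluation:
  assumes "(f \<longlongrightarrow> l) F"
  shows "((\<lambda>i. dual_apply (f i) x) \<longlongrightarrow> dual_apply l x) F"
  using continuous_on_tendsto_compose[OF continuous_on_dual_evaluation assms] by simp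

text \<open>The weak-star topology is pulled back along \<^const>\<open>dual_apply\<close>, so every open cover of \<open>C\<close>
  comes from one of its image in the product space.\<close>

lemma compact_dual_if_compact_image:
  assumes "compact (dual_apply ` C)"
  shows "compact C"
proof (rule compactI)
  fix \<U> assume cov: "C \<subseteq> \<Union>\<U>" and "\<forall>U\<in>\<U>. open U"
  then have "\<forall>U\<in>\<U>. \<exists>V. open V \<and> U = dual_apply -` V"
    unfolding open_dual_def by simp
  from bchoice[OF this] obtain V where V: "\<forall>U\<in>\<U>. open (V U) \<and> U = dual_apply -` V U" ..
  have mem: "dual_apply l \<in> V U \<longleftrightarrow> l \<in> U" if "U \<in> \<U>" for l U
    using bspec[OF V that] by (metis vimage_eq)
  have "dual_apply ` C \<subseteq> (\<Union>U\<in>\<U>. V U)"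
  proof (rule image_subsetI)
    fix l assume "l \<in> C"
    then obtain U where "U \<in> \<U>" "l \<in> U" using cov by auto
    with mem show "dual_apply l \<in> (\<Union>U\<in>\<U>. V U)" by auto
  qed
  moreover have "open (V U)" if "U \<in> \<U>" for U
    using bspec[OF V that] by simp
  ultimately obtain \<U>' where sub: "\<U>' \<subseteq> \<U>" and fin: "finite \<U>'"
    and cov': "dual_apply ` C \<subseteq> (\<Union>U\<in>\<U>'. V U)"
    using compactE_image[OF assms, of \<U> V] by metis
  have "C \<subseteq> \<Union>\<U>'"
  proof
    fix l assume "l \<in> C"
    then obtain U where "U \<in> \<U>'" "dual_apply l \<in> V U" using cov' by auto
    with mem sub show "l \<in> \<Union>\<U>'" by auto
  qed
  with sub fin show "\<exists>\<U>'\<subseteq>\<U>. finite \<U>' \<and> C \<subseteq> \<Union>\<U>'"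
    by (intro exI[of _ \<U>'] conjI)
qed

text \<open>Tychonoff's theorem: \<open>V\<close> absorbs every \<open>d\<close> and \<open>- d\<close>, which confines the functionals to a
  product of compact intervals, where linearity and the bound on \<open>V\<close> are closed conditions. A
  pointwise limit stays continuous because it is still bounded above on the neighbourhood \<open>V\<close>.\<close>

lemma Banach_Alaoglu:
  fixes V :: "'a::lc_space set"
  assumes V: "\<forall>\<^sub>F d in nhds 0. d \<in> V"
  shows "compact {l. \<forall>d\<in>V. dual_apply l d \<le> M}"
proof -
  have "\<exists>t>0. t *\<^sub>R d \<in> V \<and> (- t) *\<^sub>R d \<in> V" for d
  proof -
    have "((\<lambda>t. t *\<^sub>R d) \<longlongrightarrow> 0 *\<^sub>R d) (at_right 0)" "((\<lambda>t. (- t) *\<^sub>R d) \<longlongrightarrow> (- 0) *\<^sub>R d) (at_right 0)"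
      by (intro tendsto_scaleR_lc tendsto_intros)+
    then have "((\<lambda>t. t *\<^sub>R d) \<longlongrightarrow> 0) (at_right 0)" "((\<lambda>t. (- t) *\<^sub>R d) \<longlongrightarrow> 0) (at_right 0)"
      by simp_all
    then have "\<forall>\<^sub>F t in at_right (0::real). t *\<^sub>R d \<in> V" "\<forall>\<^sub>F t in at_right (0::real). (- t) *\<^sub>R d \<in> V"
      using V by (auto elim: eventually_compose_filterlim)
    moreover have "\<forall>\<^sub>F t in at_right (0::real). 0 < t"
      by (simp add: eventually_at_right_less)
    ultimately have "\<forall>\<^sub>F t in at_right (0::real). t > 0 \<and> t *\<^sub>R d \<in> V \<and> (- t) *\<^sub>R d \<in> V"
      by (simp add: eventually_conj)
    then show ?thesis
      using eventually_happens trivial_limit_at_right_real by blast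
  qed
  then obtain t where t: "\<And>d. t d > 0" "\<And>d. t d *\<^sub>R d \<in> V" "\<And>d. (- t d) *\<^sub>R d \<in> V"
    by metis
  let ?P = "Pi\<^sub>E UNIV (\<lambda>d. {- M / t d .. M / t d})"
  let ?L = "{f. (\<forall>x y. f (x + y) = f x + f y) \<and> (\<forall>r x. f (r *\<^sub>R x) = r * f x) \<and> (\<forall>d\<in>V. f d \<le> M)}"
  have "compact ?P"
    using compactin_PiE[of "\<lambda>_::'a. euclidean :: real topology" UNIV]
    by (simp add: euclidean_product_topology)
  moreover have "closed ?L"
    unfolding Ball_def
    by (intro closed_Collect_conj closed_Collect_all closed_Collect_imp closed_Collect_eq
        closed_Collect_le continuous_intros) auto
  ultimately have "compact (?P \<inter> ?L)"
    by (rule compact_Int_closed)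
  moreover have "dual_apply ` {l. \<forall>d\<in>V. dual_apply l d \<le> M} = ?P \<inter> ?L"
  proof (intro equalityI subsetI)
    fix f assume "f \<in> dual_apply ` {l. \<forall>d\<in>V. dual_apply l d \<le> M}"
    then obtain l where f: "f = dual_apply l" and l: "\<And>d. d \<in> V \<Longrightarrow> dual_apply l d \<le> M" by blast
    have "- M \<le> t d * dual_apply l d \<and> t d * dual_apply l d \<le> M" for d
      using l[OF t(2)[of d]] l[OF t(3)[of d]] by (simp add: linear_scale[OF linear_dual_apply] linear_neg[OF linear_dual_apply])
    then have "- M / t d \<le> dual_apply l d \<and> dual_apply l d \<le> M / t d" for d
      using t(1)[of d] by (simp add: field_simps)
    then show "f \<in> ?P \<inter> ?L"
      using l by (simp add: f PiE_UNIV_domain linear_add[OF linear_dual_apply] linear_scale[OF linear_dual_apply])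
  next
    fix f assume f: "f \<in> ?P \<inter> ?L"
    then have lin: "linear f"
      by (intro linearI) auto
    moreover have "\<forall>\<^sub>F d in nhds 0. f d \<le> M"
      using V by eventually_elim (use f in auto)
    ultimately have "dual_apply (Dual f) = f"
      using linear_bounded_above_imp_continuous by (intro Dual_inverse) auto
    then show "f \<in> dual_apply ` {l. \<forall>d\<in>V. dual_apply l d \<le> M}"
      using f by (intro image_eqI[of _ _ "Dual f"]) auto
  qed
  ultimately show ?thesis
    by (intro compact_dual_if_compact_image) simp
qed

section \<open>A linear minorant of a sublinear functional\<close>

text \<open>Only one inequality is asked for in the homogeneity clause; this is all that an infimum of
  such functions inherits directly, and the equality follows by rescaling.\<close>

definition sublinear :: "('a::real_vector \<Rightarrow> real) \<Rightarrow> bool" where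
  "sublinear p \<longleftrightarrow> (\<forall>x y. p (x + y) \<le> p x + p y) \<and> (\<forall>t>0. \<forall>x. p (t *\<^sub>R x) \<le> t * p x)"

lemma sublinear_zero:
  assumes "sublinear p" shows "p 0 = 0"
proof -
  have "p (0 + 0) \<le> p 0 + p 0" "p ((1/2) *\<^sub>R 0) \<le> (1/2) * p 0"
    using assms unfolding sublinear_def by (blast, meson half_gt_zero zero_less_one)
  then show ?thesis by simp
qed

lemma sublinear_scale:
  assumes "sublinear p" "t \<ge> 0" shows "p (t *\<^sub>R x) = t * p x"
proof (cases "t = 0")
  case False
  then have t: "t > 0" using assms by simp
  have "p ((1/t) *\<^sub>R (t *\<^sub>R x)) \<le> (1/t) * p (t *\<^sub>R x)" "p (t *\<^sub>R x) \<le> t * p x"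
    using assms t unfolding sublinear_def by (metis zero_less_divide_1_iff, blast)
  then show ?thesis using t by (simp add: field_simps)
qed (simp add: sublinear_zero[OF assms(1)])

lemma sublinear_minus:
  assumes "sublinear p" shows "- p (- x) \<le> p x"
proof -
  have "p (x + - x) \<le> p x + p (- x)" using assms unfolding sublinear_def by blast
  then show ?thesis using sublinear_zero[OF assms] by simp
qed

text \<open>For fixed \<open>y\<close>, the infimum over \<open>t \<ge> 0\<close> of \<open>q (x + t y) - t q(y)\<close> is again sublinear in \<open>x\<close>
  and lies below \<open>q\<close>. By minimality it equals \<open>q\<close>, and its term at \<open>t = 1\<close> then gives
  \<open>q x + q y \<le> q (x + y)\<close>: a minimal sublinear functional is also superadditive.\<close>

lemma minimal_sublinear_imp_linear:
  assumes q: "sublinear q" and min: "\<And>r. sublinear r \<Longrightarrow> r \<le> q \<Longrightarrow> r = q"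
  shows "linear q"
proof -
  have sub: "q (x + y) \<le> q x + q y" for x y using q unfolding sublinear_def by blast
  have super: "q x + q y \<le> q (x + y)" for x y
  proof -
    let ?g = "\<lambda>x t. q (x + t *\<^sub>R y) - t * q y"
    define r where "r x = (INF t\<in>{0..}. ?g x t)" for x
    have bdd: "bdd_below (?g x ` {0..})" for x
    proof (intro bdd_belowI2)
      fix t :: real assume t: "t \<in> {0..}"
      have "t * q y = q ((x + t *\<^sub>R y) + - x)" using sublinear_scale[OF q] t by simp
      also have "\<dots> \<le> q (x + t *\<^sub>R y) + q (- x)" by (rule sub)
      finally show "- q (- x) \<le> ?g x t" by simp
    qed
    have r_le: "r x \<le> ?g x t" if "t \<ge> 0" for x t
      unfolding r_def using bdd that by (intro cINF_lower) auto
    have "sublinear r" unfolding sublinear_def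
    proof (intro conjI allI impI)
      fix x1 x2
      have "r (x1 + x2) - ?g x1 s \<le> r x2" if s: "s \<ge> 0" for s
        unfolding r_def[of x2]
      proof (rule cINF_greatest)
        fix t :: real assume t: "t \<in> {0..}"
        have "r (x1 + x2) \<le> q ((x1 + s *\<^sub>R y) + (x2 + t *\<^sub>R y)) - (s + t) * q y"
          using r_le[of "s + t" "x1 + x2"] s t by (simp add: algebra_simps)
        also have "\<dots> \<le> ?g x1 s + ?g x2 t"
          using sub[of "x1 + s *\<^sub>R y" "x2 + t *\<^sub>R y"] by (simp add: algebra_simps)
        finally show "r (x1 + x2) - ?g x1 s \<le> ?g x2 t" by simp
      qed simp
      then have "r (x1 + x2) - r x2 \<le> r x1"
        unfolding r_def[of x1] by (intro cINF_greatest) (auto simp: algebra_simps)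
      then show "r (x1 + x2) \<le> r x1 + r x2" by simp
    next
      fix c :: real and x assume c: "c > 0"
      have "r (c *\<^sub>R x) / c \<le> r x"
        unfolding r_def[of x]
      proof (rule cINF_greatest)
        fix t :: real assume t: "t \<in> {0..}"
        have "r (c *\<^sub>R x) \<le> q (c *\<^sub>R (x + t *\<^sub>R y)) - c * t * q y"
          using r_le[of "c * t" "c *\<^sub>R x"] c t by (simp add: algebra_simps)
        also have "\<dots> = c * ?g x t" using c sublinear_scale[OF q, of c "x + t *\<^sub>R y"] by (simp add: algebra_simps)
        finally show "r (c *\<^sub>R x) / c \<le> ?g x t" using c by (simp add: field_simps)
      qed simp
      then show "r (c *\<^sub>R x) \<le> c * r x" using c by (simp add: field_simps)
    qed
    moreover have "r \<le> q" using r_le[of 0] by (simp add: le_fun_def)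
    ultimately have "r = q" by (rule min)
    then show ?thesis using r_le[of 1 x] by simp
  qed
  have add: "q (x + y) = q x + q y" for x y using sub super by (rule antisym)
  show ?thesis
  proof (rule linearI)
    fix c :: real and x
    have neg: "q (- x) = - q x" for x using add[of x "- x"] sublinear_zero[OF q] by simp
    show "q (c *\<^sub>R x) = c *\<^sub>R q x"
      using sublinear_scale[OF q, of c x] sublinear_scale[OF q, of "- c" x] neg[of "c *\<^sub>R x"]
      by (cases "c \<ge> 0") auto
  qed (rule add)
qed

text \<open>A minimal sublinear functional below \<open>p\<close> exists by Zorn's lemma. The pointwise infimum of a chain
  is finite because each member dominates \<open>x \<mapsto> - p (- x)\<close>, and it is subadditive because
  of any two members one lies below the other.\<close>

lemma Hahn_Banach_sublinear:
  assumes p: "sublinear p"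
  obtains l where "linear l" "l \<le> p"
proof -
  let ?A = "{q. sublinear q \<and> q \<le> p}"
  let ?R = "relation_of (\<lambda>a b. b \<le> a) ?A"
  have "\<exists>m\<in>?A. \<forall>a\<in>?A. a \<le> m \<longrightarrow> a = m"
  proof (rule predicate_Zorn)
    show "partial_order_on ?A ?R"
      by (auto simp: partial_order_on_def preorder_on_def refl_on_def trans_def antisym_def relation_of_def)
  next
    fix C assume "C \<in> Chains ?R"
    then have CA: "C \<subseteq> ?A" and ch: "\<And>a b. a \<in> C \<Longrightarrow> b \<in> C \<Longrightarrow> a \<le> b \<or> b \<le> a"
      unfolding Chains_def relation_of_def by blast+
    show "\<exists>u\<in>?A. \<forall>a\<in>C. u \<le> a"
    proof (cases "C = {}")
      case True
      with p show ?thesis by blast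
    next
      case False
      define u where "u x = (INF q\<in>C. q x)" for x
      have bdd: "bdd_below ((\<lambda>q. q x) ` C)" for x
      proof (intro bdd_belowI2)
        fix q assume "q \<in> C"
        with CA have "sublinear q" "q (- x) \<le> p (- x)" by (auto simp: le_fun_def)
        then show "- p (- x) \<le> q x" using sublinear_minus[of q x] by simp
      qed
      have u_le: "u x \<le> q x" if "q \<in> C" for x q
        unfolding u_def using bdd that by (rule cINF_lower)
      have "sublinear u" unfolding sublinear_def
      proof (intro conjI allI impI)
        fix x y
        have "u (x + y) \<le> q1 x + q2 y" if q: "q1 \<in> C" "q2 \<in> C" for q1 q2
        proof -
          obtain q where qC: "q \<in> C" and le: "q \<le> q1" "q \<le> q2" using ch[OF q] q by blast
          have "u (x + y) \<le> q (x + y)" using qC by (rule u_le)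
          also have "\<dots> \<le> q x + q y" using CA qC by (auto simp: sublinear_def)
          also have "\<dots> \<le> q1 x + q2 y" using le by (intro add_mono) (auto simp: le_fun_def)
          finally show ?thesis .
        qed
        then have "u (x + y) - q1 x \<le> q2 y" if "q1 \<in> C" "q2 \<in> C" for q1 q2
          using that by (simp add: diff_le_eq add.commute)
        then have "u (x + y) - q1 x \<le> u y" if "q1 \<in> C" for q1
          unfolding u_def[of y] using False that by (intro cINF_greatest)
        then have "u (x + y) - u y \<le> q1 x" if "q1 \<in> C" for q1
          using that by (simp add: diff_le_eq add.commute)
        then have "u (x + y) - u y \<le> u x"
          unfolding u_def[of x] using False by (intro cINF_greatest)
        then show "u (x + y) \<le> u x + u y" by simp
      next
        fix t :: real and x assume t: "t > 0"
        have "u (t *\<^sub>R x) / t \<le> u x"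
          unfolding u_def[of x]
        proof (rule cINF_greatest[OF False])
          fix q assume q: "q \<in> C"
          then have "q (t *\<^sub>R x) \<le> t * q x" using CA t by (auto simp: sublinear_def)
          with u_le[OF q, of "t *\<^sub>R x"] show "u (t *\<^sub>R x) / t \<le> q x"
            using t by (simp add: field_simps)
        qed
        then show "u (t *\<^sub>R x) \<le> t * u x" using t by (simp add: field_simps)
      qed
      moreover have "u \<le> p"
      proof -
        obtain q where "q \<in> C" using False by blast
        with CA u_le[of q] have "u \<le> q" "q \<le> p" by (auto simp: le_fun_def)
        then show ?thesis by (rule order_trans)
      qed
      ultimately show ?thesis using u_le by (auto simp: le_fun_def)
    qed
  qed
  then obtain m where m: "sublinear m" "m \<le> p" "\<And>a. sublinear a \<Longrightarrow> a \<le> p \<Longrightarrow> a \<le> m \<Longrightarrow> a = m"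
    by blast
  have "linear m"
    using m by (intro minimal_sublinear_imp_linear) (auto intro: order_trans)
  with m(2) that show thesis by blast
qed

section \<open>Subgradients of extended-real functions\<close>

text \<open>Quantifying over real upper bounds \<open>b\<close> of \<open>f y\<close> replaces the case distinction on infinite values
  of \<open>f y\<close> and leaves only real arithmetic.\<close>

lemma eps_subdiff_iff:
  assumes "f x = ereal a"
  shows "l \<in> eps_subdiff e f x \<longleftrightarrow> (\<forall>y b. f y \<le> ereal b \<longrightarrow> dual_apply l (y - x) \<le> b - a + e)"
proof -
  have "ereal c \<le> f y - f x + ereal e \<longleftrightarrow> (\<forall>b. f y \<le> ereal b \<longrightarrow> c \<le> b - a + e)" for c y
  proof (cases "f y")
    case (real b)
    have "(\<forall>b'. b \<le> b' \<longrightarrow> c \<le> b' - a + e) \<longleftrightarrow> c \<le> b - a + e"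
      by (auto intro: order_trans[of c "b - a + e"])
    with real assms show ?thesis by simp
  next
    case MInf
    have "\<not> c \<le> (c + a - e - 1) - a + e" by simp
    with MInf assms show ?thesis by (auto intro!: exI[of _ "c + a - e - 1"])
  qed (use assms in simp)
  with assms show ?thesis by (simp add: eps_subdiff_def)
qed

text \<open>A subgradient at one point is an approximate subgradient at every other point; the error is
  the gap between \<open>f z\<close> and the affine minorant of slope \<open>l\<close> taken at \<open>x\<close>.\<close>

lemma eps_subdiff_change_point:
  assumes l: "l \<in> eps_subdiff e f x" and x: "f x = ereal a" and z: "f z = ereal b"
  shows "l \<in> eps_subdiff (e + b - a + dual_apply l (x - z)) f z"
  unfolding eps_subdiff_iff[of f z, OF z]
proof (intro allI impI)
  fix y c assume "f y \<le> ereal c"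
  then have "dual_apply l (y - x) \<le> c - a + e"
    using l unfolding eps_subdiff_iff[of f x, OF x] by blast
  then show "dual_apply l (y - z) \<le> c - b + (e + b - a + dual_apply l (x - z))"
    by (simp add: linear_diff[OF linear_dual_apply])
qed

lemma convex_fun_le:
  assumes "convex_fun f" "f x \<le> ereal a" "f y \<le> ereal b" "u \<ge> 0" "v \<ge> 0" "u + v = 1"
  shows "f (u *\<^sub>R x + v *\<^sub>R y) \<le> ereal (u * a + v * b)"
proof -
  have "f (u *\<^sub>R x + v *\<^sub>R y) \<le> ereal u * f x + ereal v * f y"
    using assms unfolding convex_fun_def by blast
  also have "\<dots> \<le> ereal u * ereal a + ereal v * ereal b"
    using assms by (intro add_mono ereal_mult_left_mono) auto
  finally show ?thesis by simp
qed

text \<open>\<open>D d\<close> collects the upper bounds for the difference quotients of \<open>h\<close> at \<open>x\<close> in the direction \<open>d\<close>,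
  so \<open>p\<close> is the directional derivative of \<open>h\<close> at \<open>x\<close>. Convexity makes it sublinear, and a linear
  functional below it is a subgradient; the bound on \<open>h\<close> near \<open>x\<close> yields both the finiteness of \<open>p\<close>
  and the continuity of that functional.\<close>

lemma subdiff_nonempty:
  fixes h :: "'a::lc_space \<Rightarrow> ereal"
  assumes cv: "convex_fun h" and hx: "h x = ereal a" and bd: "\<forall>\<^sub>F y in nhds x. h y \<le> ereal M"
  shows "subdiff h x \<noteq> {}"
proof -
  define D where "D d = {c. \<exists>t>0. h (x + t *\<^sub>R d) \<le> ereal (a + t * c)}" for d
  define p where "p d = Inf (D d)" for d
  have D_add: "c1 + c2 \<in> D (d1 + d2)" if D: "c1 \<in> D d1" "c2 \<in> D d2" for c1 c2 d1 d2
  proof -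
    obtain t1 t2 where t: "t1 > 0" "t2 > 0"
      and h1: "h (x + t1 *\<^sub>R d1) \<le> ereal (a + t1 * c1)" and h2: "h (x + t2 *\<^sub>R d2) \<le> ereal (a + t2 * c2)"
      using D unfolding D_def by blast
    \<comment> \<open>With these weights both steps contribute the same multiple \<open>r\<close> of their direction.\<close>
    define u v r where "u = t2 / (t1 + t2)" and "v = t1 / (t1 + t2)" and "r = t1 * t2 / (t1 + t2)"
    have uv: "u \<ge> 0" "v \<ge> 0" "u + v = 1" and r: "u * t1 = r" "v * t2 = r" "r > 0"
      using t by (auto simp: u_def v_def r_def divide_simps)
    have "u *\<^sub>R (x + t1 *\<^sub>R d1) + v *\<^sub>R (x + t2 *\<^sub>R d2) = (u + v) *\<^sub>R x + (u * t1) *\<^sub>R d1 + (v * t2) *\<^sub>R d2"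
      by (simp add: algebra_simps)
    also have "\<dots> = x + r *\<^sub>R (d1 + d2)" unfolding uv r by (simp add: algebra_simps)
    finally have 1: "u *\<^sub>R (x + t1 *\<^sub>R d1) + v *\<^sub>R (x + t2 *\<^sub>R d2) = x + r *\<^sub>R (d1 + d2)" .
    have "u * (a + t1 * c1) + v * (a + t2 * c2) = (u + v) * a + (u * t1) * c1 + (v * t2) * c2"
      by (simp add: algebra_simps)
    also have "\<dots> = a + r * (c1 + c2)" unfolding uv r by (simp add: algebra_simps)
    finally have "h (x + r *\<^sub>R (d1 + d2)) \<le> ereal (a + r * (c1 + c2))"
      using convex_fun_le[OF cv h1 h2 uv] unfolding 1 by simp
    with r show ?thesis unfolding D_def by blast
  qed
  have D_scale: "s * c \<in> D (s *\<^sub>R d)" if c: "c \<in> D d" and s: "s > 0" for c d s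
  proof -
    obtain t where "t > 0" "h (x + t *\<^sub>R d) \<le> ereal (a + t * c)" using c unfolding D_def by blast
    then show ?thesis
      using s unfolding D_def by (intro CollectI exI[of _ "t / s"]) simp
  qed
  have D_zero: "0 \<le> c" if c: "c \<in> D 0" for c
    using c hx by (auto simp: D_def zero_le_mult_iff)
  have D_ne: "D d \<noteq> {}" for d
  proof -
    have "((\<lambda>t. x + t *\<^sub>R d) \<longlongrightarrow> x + 0 *\<^sub>R d) (at_right 0)"
      by (intro tendsto_add tendsto_scaleR_lc tendsto_const tendsto_ident_at)
    then have "((\<lambda>t. x + t *\<^sub>R d) \<longlongrightarrow> x) (at_right 0)" by simp
    with bd have "\<forall>\<^sub>F t in at_right (0::real). h (x + t *\<^sub>R d) \<le> ereal M"
      by (rule eventually_compose_filterlim)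
    moreover have "\<forall>\<^sub>F t in at_right (0::real). 0 < t" by (simp add: eventually_at_right_less)
    ultimately have "\<forall>\<^sub>F t in at_right (0::real). h (x + t *\<^sub>R d) \<le> ereal M \<and> 0 < t"
      by (rule eventually_conj)
    then obtain t where "t > 0" "h (x + t *\<^sub>R d) \<le> ereal M"
      using eventually_happens trivial_limit_at_right_real by blast
    then have "(M - a) / t \<in> D d" unfolding D_def by (intro CollectI exI[of _ t]) simp
    then show ?thesis by blast
  qed
  have D_bdd: "bdd_below (D d)" for d
  proof -
    obtain c' where "c' \<in> D (- d)" using D_ne by blast
    then have "- c' \<le> c" if "c \<in> D d" for c
      using D_zero[of "c + c'"] D_add[OF that \<open>c' \<in> D (- d)\<close>] by simp
    then show ?thesis by (rule bdd_belowI)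
  qed
  have p_le: "p d \<le> c" if "c \<in> D d" for c d
    unfolding p_def using that D_bdd by (rule cInf_lower)
  have "sublinear p" unfolding sublinear_def
  proof (intro conjI allI impI)
    fix d1 d2
    have "p (d1 + d2) - c1 \<le> c2" if "c1 \<in> D d1" "c2 \<in> D d2" for c1 c2
      using p_le[OF D_add[OF that]] by simp
    then have "p (d1 + d2) - c1 \<le> p d2" if "c1 \<in> D d1" for c1
      unfolding p_def[of d2] using D_ne that by (intro cInf_greatest)
    then have "p (d1 + d2) - p d2 \<le> c1" if "c1 \<in> D d1" for c1
      using that by (simp add: diff_le_eq add.commute)
    then have "p (d1 + d2) - p d2 \<le> p d1"
      unfolding p_def[of d1] using D_ne by (intro cInf_greatest)
    then show "p (d1 + d2) \<le> p d1 + p d2" by simp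
  next
    fix s :: real and d assume s: "s > 0"
    have "p (s *\<^sub>R d) / s \<le> p d"
      unfolding p_def[of d] using D_ne p_le[OF D_scale[OF _ s]] s
      by (intro cInf_greatest) (auto simp: field_simps)
    then show "p (s *\<^sub>R d) \<le> s * p d" using s by (simp add: field_simps)
  qed
  then obtain l where lin: "linear l" and lp: "l \<le> p" by (rule Hahn_Banach_sublinear)
  have l_le: "l d \<le> b - a" if "h (x + d) \<le> ereal b" for d b
  proof -
    have "b - a \<in> D d" unfolding D_def using that by (intro CollectI exI[of _ 1]) simp
    from p_le[OF this] le_funD[OF lp, of d] show ?thesis by simp
  qed
  have "((\<lambda>d. x + d) \<longlongrightarrow> x + 0) (nhds 0)"
    by (intro tendsto_add tendsto_const filterlim_ident)
  then have "((\<lambda>d. x + d) \<longlongrightarrow> x) (nhds 0)" by simp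
  with bd have "\<forall>\<^sub>F d in nhds 0. h (x + d) \<le> ereal M"
    by (rule eventually_compose_filterlim)
  then have "\<forall>\<^sub>F d in nhds 0. l d \<le> M - a"
    by eventually_elim (rule l_le)
  with lin have "dual_apply (Dual l) = l"
    by (intro Dual_inverse) (auto intro: linear_bounded_above_imp_continuous)
  then have "Dual l \<in> subdiff h x"
    unfolding eps_subdiff_iff[of h x, OF hx] using l_le[of "_ - x"] by simp
  then show ?thesis by blast
qed

section \<open>Limits of common subgradients\<close>

text \<open>Passing to a finer filter is what passing to a convergent subnet is for nets.\<close>

lemma compact_limit_along_finer_filter:
  assumes "compact S" "F \<noteq> bot" "\<forall>\<^sub>F i in F. f i \<in> S"
  obtains H l where "H \<le> F" "H \<noteq> bot" "l \<in> S" "(f \<longlongrightarrow> l) H"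
proof -
  have "filtermap f F \<noteq> bot" "\<forall>\<^sub>F z in filtermap f F. z \<in> S"
    using assms by (simp_all add: filtermap_bot_iff eventually_filtermap)
  then obtain l where l: "l \<in> S" "inf (nhds l) (filtermap f F) \<noteq> bot"
    using \<open>compact S\<close> unfolding compact_filter by blast
  let ?H = "inf F (filtercomap f (nhds l))"
  have "?H \<noteq> bot"
  proof
    assume "?H = bot"
    then obtain P Q where P: "eventually P F" and Q: "eventually Q (nhds l)" and PQ: "\<And>i. P i \<Longrightarrow> Q (f i) \<Longrightarrow> False"
      unfolding trivial_limit_def eventually_inf eventually_filtercomap by blast
    have "eventually (\<lambda>z. \<not> Q z) (filtermap f F)"
      unfolding eventually_filtermap using P by eventually_elim (use PQ in blast)
    with Q l(2) show False
      unfolding trivial_limit_def eventually_inf by blast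
  qed
  moreover have "(f \<longlongrightarrow> l) ?H"
    by (rule filterlim_mono[OF filterlim_filtercomap order_refl]) simp
  ultimately show thesis using l(1) by (intro that[of ?H l]) auto
qed

lemma tendsto_reflection:
  fixes a :: "'a::topological_ab_group_add"
  shows "((\<lambda>x. x + (x - a)) \<longlongrightarrow> a) (nhds a)"
proof -
  have "((\<lambda>x. x + (x - a)) \<longlongrightarrow> a + (a - a)) (nhds a)"
    by (intro tendsto_add tendsto_diff filterlim_ident tendsto_const)
  then show ?thesis by simp
qed

lemma isCont_imp_tendsto_nhds: "isCont f x \<Longrightarrow> (f \<longlongrightarrow> f x) (nhds x)"
  by (simp add: isCont_def tendsto_at_iff_tendsto_nhds)

lemma eventually_finite_near:
  fixes h :: "'a::t2_space \<Rightarrow> ereal"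
  assumes "isCont h x" "h x = ereal a" 
  shows "\<forall>\<^sub>F y in nhds x. h y = ereal (real_of_ereal (h y)) \<and> a - 1 \<le> real_of_ereal (h y) \<and> h y \<le> ereal (a + 1)"
proof -
  have "(h \<longlongrightarrow> ereal a) (nhds x)"
    using isCont_imp_tendsto_nhds[of x h] assms by simp
  then have "\<forall>\<^sub>F y in nhds x. ereal (a - 1) < h y" "\<forall>\<^sub>F y in nhds x. h y < ereal (a + 1)"
    by (auto elim!: order_tendstoD)
  then show ?thesis
  proof eventually_elim
    case (elim y)
    then show ?case by (cases "h y") auto
  qed
qed

text \<open>Near \<open>xbar\<close> the subgradients of \<open>h\<close> are uniformly bounded above on a neighbourhood of 0, hence
  lie in a weak-star compact set. Together with the compactness of \<open>B\<close> this gives a limit \<open>(s, l)\<close> of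
  the pairs formed by a common subgradient and its multiplier, along points tending to \<open>xbar\<close>. Both
  subgradient inequalities survive in the limit. As the constraint map carries no continuity, the
  value of the limiting multiplier at \<open>xbar\<close> is not known to vanish; therefore the second inequality
  is concluded in a form that does not mention that value.\<close>

lemma limit_of_common_subgradients:
  fixes h :: "'x::lc_space \<Rightarrow> ereal" and \<Phi> :: "'x \<Rightarrow> 'y::lc_space option"
  assumes B: "compact B" and hx: "h xbar = ereal a" and cont: "isCont h xbar"
    and freq: "\<exists>\<^sub>F x in nhds xbar. \<exists>l\<in>B. scalarize l \<Phi> x = 0 \<and>
       subdiff h x \<inter> subdiff (\<lambda>x. scalarize l \<Phi> x + h x) x \<noteq> {}"
  obtains l s where "l \<in> B" "s \<in> subdiff h xbar"
    "\<forall>y v b. \<Phi> y = Some v \<longrightarrow> h y \<le> ereal b \<longrightarrow>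
      dual_apply s (y - xbar) \<le> dual_apply l v + b - a"
proof -
  define r where "r x = real_of_ereal (h x)" for x
  have lim_h: "(h \<longlongrightarrow> ereal a) (nhds xbar)"
    using isCont_imp_tendsto_nhds[OF cont] hx by simp
  have lim_r: "(r \<longlongrightarrow> a) (nhds xbar)"
    unfolding r_def using lim_h by (rule lim_real_of_ereal)
  have fin: "\<forall>\<^sub>F x in nhds xbar. h x = ereal (r x) \<and> a - 1 \<le> r x \<and> h x \<le> ereal (a + 1)"
    unfolding r_def using eventually_finite_near[OF cont hx] .
  have "((\<lambda>z. fst z + snd z) \<longlongrightarrow> xbar + 0) (nhds xbar \<times>\<^sub>F nhds 0)"
    by (intro tendsto_add filterlim_fst filterlim_snd)
  then have "((\<lambda>z. fst z + snd z) \<longlongrightarrow> xbar) (nhds xbar \<times>\<^sub>F nhds 0)" by simp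
  from eventually_compose_filterlim[OF fin this]
  have "\<forall>\<^sub>F z in nhds xbar \<times>\<^sub>F nhds 0. h (fst z + snd z) \<le> ereal (a + 1)"
    by (simp add: eventually_conj_iff)
  then obtain P Q where P: "eventually P (nhds xbar)" and Q: "eventually Q (nhds 0)"
    and PQ: "\<And>x d. P x \<Longrightarrow> Q d \<Longrightarrow> h (x + d) \<le> ereal (a + 1)"
    unfolding eventually_prod_filter by auto
  define C where "C = {s. \<forall>d\<in>{d. Q d}. dual_apply s d \<le> (2::real)}"
  have C: "compact C"
    unfolding C_def using Q by (intro Banach_Alaoglu) simp
  \<comment> \<open>The pairs to be followed: points \<open>x\<close> with a multiplier \<open>l\<close> and a common subgradient \<open>s\<close>.\<close>
  define bad where "bad x s l \<longleftrightarrow> l \<in> B \<and> scalarize l \<Phi> x = 0 \<and> s \<in> subdiff h x \<and>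
      s \<in> subdiff (\<lambda>x. scalarize l \<Phi> x + h x) x" for x s l
  define F where "F = inf (nhds xbar) (principal {x. \<exists>s l. bad x s l})"
  have "\<exists>\<^sub>F x in nhds xbar. \<exists>s l. bad x s l"
    using freq by (rule frequently_elim1) (auto simp: bad_def)
  then have F: "F \<noteq> bot"
    by (simp add: F_def trivial_limit_def eventually_inf_principal frequently_def)
  have "\<forall>x\<in>{x. \<exists>s l. bad x s l}. \<exists>s l. bad x s l" by blast
  then obtain s l where sl: "\<forall>x\<in>{x. \<exists>s l. bad x s l}. bad x (s x) (l x)"
    unfolding bchoice_iff by blast
  have F_le: "F \<le> nhds xbar" by (simp add: F_def)
  have bad_F: "\<forall>\<^sub>F x in F. bad x (s x) (l x)"
    unfolding F_def eventually_inf_principal using sl by (auto intro!: always_eventually)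
  have "\<forall>\<^sub>F x in F. (s x, l x) \<in> C \<times> B"
    using bad_F filter_leD[OF F_le fin] filter_leD[OF F_le P]
  proof eventually_elim
    case (elim x)
    have sx: "s x \<in> subdiff h x" and hx': "h x = ereal (r x)" using elim by (auto simp: bad_def)
    have "dual_apply (s x) d \<le> 2" if "Q d" for d
    proof -
      have "dual_apply (s x) (x + d - x) \<le> (a + 1) - r x + 0"
        using sx PQ[OF elim(3) that] unfolding eps_subdiff_iff[of h x, OF hx'] by blast
      with elim show ?thesis by simp
    qed
    with elim show ?case by (simp add: C_def bad_def)
  qed
  then obtain H z where H: "H \<le> F" "H \<noteq> bot" "z \<in> C \<times> B" "((\<lambda>x. (s x, l x)) \<longlongrightarrow> z) H"
    by (rule compact_limit_along_finer_filter[OF compact_Times[OF C B] F])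
  obtain s0 l0 where z: "z = (s0, l0)" by (cases z)
  have H_le: "H \<le> nhds xbar" using H(1) F_le by (rule order_trans)
  have lim_s: "((\<lambda>x. dual_apply (s x) v) \<longlongrightarrow> dual_apply s0 v) H" for v
    using tendsto_dual_evaluation[OF tendsto_fst[OF H(4)]] by (simp add: z)
  have lim_l: "((\<lambda>x. dual_apply (l x) v) \<longlongrightarrow> dual_apply l0 v) H" for v
    using tendsto_dual_evaluation[OF tendsto_snd[OF H(4)]] by (simp add: z)
  have lim_rH: "(r \<longlongrightarrow> a) H" using tendsto_mono[OF H_le lim_r] .
  have bad_H: "\<forall>\<^sub>F x in H. bad x (s x) (l x) \<and> h x = ereal (r x)"
    using filter_leD[OF H(1) bad_F] filter_leD[OF H_le fin] by eventually_elim auto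
  have reflect: "((\<lambda>x. x + (x - xbar)) \<longlongrightarrow> xbar) (nhds xbar)"
    using tendsto_reflection .
  have lim_refl: "((\<lambda>x. r (x + (x - xbar))) \<longlongrightarrow> a) H"
    using tendsto_mono[OF H_le filterlim_compose[OF lim_r reflect]] .
  have fin_refl: "\<forall>\<^sub>F x in H. h (x + (x - xbar)) = ereal (r (x + (x - xbar)))"
  proof -
    have "\<forall>\<^sub>F x in nhds xbar. h (x + (x - xbar)) = ereal (r (x + (x - xbar)))"
      using eventually_compose_filterlim[OF fin reflect] by (simp add: eventually_conj_iff)
    then show ?thesis by (rule filter_leD[OF H_le])
  qed
  \<comment> \<open>Here the functional and its argument vary together, so pointwise convergence is not enough.
    The subgradient inequality at \<open>xbar\<close> and at the reflected point \<open>2 x - xbar\<close> squeezes the value.\<close>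
  have lim_diff: "((\<lambda>x. dual_apply (s x) (xbar - x)) \<longlongrightarrow> 0) H"
  proof (rule tendsto_sandwich)
    show "((\<lambda>x. r x - r (x + (x - xbar))) \<longlongrightarrow> 0) H" "((\<lambda>x. a - r x) \<longlongrightarrow> 0) H"
      using tendsto_diff[OF lim_rH lim_refl] tendsto_diff[OF tendsto_const[of a] lim_rH] by simp_all
    show "\<forall>\<^sub>F x in H. r x - r (x + (x - xbar)) \<le> dual_apply (s x) (xbar - x)"
      using bad_H fin_refl
    proof eventually_elim
      case (elim x)
      then have "dual_apply (s x) (x + (x - xbar) - x) \<le> r (x + (x - xbar)) - r x + 0"
        using eps_subdiff_iff[of h x "r x" "s x" 0] unfolding bad_def by (metis order_refl)
      then show ?case by (simp add: linear_diff[OF linear_dual_apply])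
    qed
    show "\<forall>\<^sub>F x in H. dual_apply (s x) (xbar - x) \<le> a - r x"
      using bad_H
    proof eventually_elim
      case (elim x)
      then show ?case
        using eps_subdiff_iff[of h x "r x" "s x" 0] hx unfolding bad_def by simp
    qed
  qed
  show thesis
  proof (rule that)
    show "l0 \<in> B" using H(3) z by simp
    show "s0 \<in> subdiff h xbar"
      unfolding eps_subdiff_iff[of h xbar, OF hx]
    proof (intro allI impI)
      fix y b assume y: "h y \<le> ereal b"
      have "dual_apply s0 (y - xbar) + 0 \<le> b - a"
      proof (rule tendsto_le[OF H(2)])
        show "((\<lambda>x. b - r x) \<longlongrightarrow> b - a) H" using lim_rH by (intro tendsto_intros)
        show "((\<lambda>x. dual_apply (s x) (y - xbar) + dual_apply (s x) (xbar - x)) \<longlongrightarrow> dual_apply s0 (y - xbar) + 0) H"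
          by (intro tendsto_add lim_s lim_diff)
        show "\<forall>\<^sub>F x in H. dual_apply (s x) (y - xbar) + dual_apply (s x) (xbar - x) \<le> b - r x"
          using bad_H
        proof eventually_elim
          case (elim x)
          then have "dual_apply (s x) (y - x) \<le> b - r x + 0"
            using y eps_subdiff_iff[of h x "r x" "s x" 0] unfolding bad_def by blast
          then show ?case by (simp add: linear_diff[OF linear_dual_apply])
        qed
      qed
      then show "dual_apply s0 (y - xbar) \<le> b - a + 0" by simp
    qed
    show "\<forall>y v b. \<Phi> y = Some v \<longrightarrow> h y \<le> ereal b \<longrightarrow>
        dual_apply s0 (y - xbar) \<le> dual_apply l0 v + b - a"
    proof (intro allI impI)
      fix y v b assume y: "\<Phi> y = Some v" "h y \<le> ereal b"
      have "dual_apply s0 (y - xbar) + 0 \<le> dual_apply l0 v + b - a"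
      proof (rule tendsto_le[OF H(2)])
        show "((\<lambda>x. dual_apply (l x) v + b - r x) \<longlongrightarrow> dual_apply l0 v + b - a) H"
          using lim_rH lim_l by (intro tendsto_intros)
        show "((\<lambda>x. dual_apply (s x) (y - xbar) + dual_apply (s x) (xbar - x)) \<longlongrightarrow> dual_apply s0 (y - xbar) + 0) H"
          by (intro tendsto_add lim_s lim_diff)
        show "\<forall>\<^sub>F x in H. dual_apply (s x) (y - xbar) + dual_apply (s x) (xbar - x) \<le> dual_apply (l x) v + b - r x"
          using bad_H
        proof eventually_elim
          case (elim x)
          let ?f = "\<lambda>z. scalarize (l x) \<Phi> z + h z"
          have fx: "?f x = ereal (r x)" using elim by (simp add: bad_def)
          have "?f y \<le> ereal (dual_apply (l x) v) + ereal b"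
            using y by (cases "h y") (auto simp: scalarize_def)
          then have "dual_apply (s x) (y - x) \<le> (dual_apply (l x) v + b) - r x + 0"
            using elim eps_subdiff_iff[of ?f x, OF fx] unfolding bad_def by simp
          then show ?case by (simp add: linear_diff[OF linear_dual_apply])
        qed
      qed
      then show "dual_apply s0 (y - xbar) \<le> dual_apply l0 v + b - a" by simp
    qed
  qed
qed

section \<open>Sufficiency of the subdifferential inclusion\<close>

text \<open>With the convention \<open>0 \<emptyset> = {0}\<close>, both sides vanish for \<open>\<alpha> = 0\<close> even when the
  subdifferential is empty.\<close>

lemma set_scale_eps_subdiff_le:
  assumes w: "w \<in> set_scale \<alpha> (eps_subdiff e f x)" and "\<alpha> \<ge> 0"
    and "f x = ereal a" "f y \<le> ereal b"
  shows "dual_apply w (y - x) \<le> \<alpha> * (b - a + e)"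
proof (cases "\<alpha> = 0")
  case True
  then show ?thesis using w by (auto simp: set_scale_def split: if_splits)
next
  case False
  then obtain v where "v \<in> eps_subdiff e f x" "w = \<alpha> *\<^sub>R v"
    using w by (auto simp: set_scale_def)
  then show ?thesis
    using assms eps_subdiff_iff[of f x a v e] by (auto intro: mult_left_mono)
qed

text \<open>If common subgradients accumulated at \<open>xbar\<close>, there would be a limiting pair \<open>(s, l)\<close>. Its
  inequality at \<open>y = xbar\<close> gives \<open>0 \<le> \<langle>l, \<Phi>(xbar)\<rangle>\<close>, and the assumed sign gives the
  converse, so the pair contradicts the qualification at \<open>xbar\<close> itself.\<close>

lemma no_common_subgradients_nearby:
  fixes h :: "'x::lc_space \<Rightarrow> ereal" and \<Phi> :: "'x \<Rightarrow> 'y::lc_space option"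
  assumes B: "compact B" and a: "h xbar = ereal a" and cont: "isCont h xbar"
    and v0: "\<Phi> xbar = Some v0" and v0_le: "\<forall>l\<in>B. dual_apply l v0 \<le> 0"
    and qual: "subdiff h xbar \<inter>
      \<Union>{subdiff (\<lambda>x. scalarize l \<Phi> x + h x) xbar | l. l \<in> B \<and> scalarize l \<Phi> xbar = 0} = {}"
  shows "\<forall>\<^sub>F x in nhds xbar. \<not> (\<exists>l\<in>B. scalarize l \<Phi> x = 0 \<and>
      subdiff h x \<inter> subdiff (\<lambda>x. scalarize l \<Phi> x + h x) x \<noteq> {})"
proof (rule ccontr)
  let ?f = "\<lambda>l x. scalarize l \<Phi> x + h x"
  assume "\<not> ?thesis"
  then have freq: "\<exists>\<^sub>F x in nhds xbar. \<exists>l\<in>B. scalarize l \<Phi> x = 0 \<and> subdiff h x \<inter> subdiff (?f l) x \<noteq> {}"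
    by (simp add: frequently_def)
  obtain l s where l: "l \<in> B" and s: "s \<in> subdiff h xbar"
    and le: "\<forall>y v b. \<Phi> y = Some v \<longrightarrow> h y \<le> ereal b \<longrightarrow>
      dual_apply s (y - xbar) \<le> dual_apply l v + b - a"
    by (rule limit_of_common_subgradients[OF B a cont freq])
  have "0 \<le> dual_apply l v0"
    using le[rule_format, OF v0, of a] a by (simp add: linear_0[OF linear_dual_apply])
  with v0_le[rule_format, OF l] have l0: "dual_apply l v0 = 0" by simp
  then have sc0: "scalarize l \<Phi> xbar = 0" by (simp add: scalarize_def v0 zero_ereal_def)
  then have fx: "?f l xbar = ereal a" by (simp add: a)
  have sf: "s \<in> subdiff (?f l) xbar"
    unfolding eps_subdiff_iff[of "?f l" xbar, OF fx]
  proof (intro allI impI)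
    fix y b assume y: "?f l y \<le> ereal b"
    then obtain v where v: "\<Phi> y = Some v" by (cases "\<Phi> y") (auto simp: scalarize_def)
    with y have "h y \<le> ereal (b - dual_apply l v)"
      by (cases "h y") (auto simp: scalarize_def)
    from le[rule_format, OF v this] show "dual_apply s (y - xbar) \<le> b - a + 0" by simp
  qed
  have "subdiff (?f l) xbar \<in> {subdiff (?f l) xbar | l. l \<in> B \<and> scalarize l \<Phi> xbar = 0}"
    by (intro CollectI exI[of _ l] conjI refl l sc0)
  from subsetD[OF equalityD1[OF qual] IntI[OF s UnionI[OF this sf]]] show False
    by (rule emptyE)
qed

text \<open>The subgradient inequality at \<open>x\<close>, tested at the reflected point \<open>2 x - xbar\<close>, bounds the error \<open>\<eta>\<close> by
  \<open>h xbar - 2 h x + h (2 x - xbar)\<close>, which tends to 0 as \<open>x\<close> tends to \<open>xbar\<close>. With this \<open>\<eta>\<close> the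
  \<open>\<eta>\<close>-subgradient inequality of \<open>s\<close> at \<open>xbar\<close> is an equality at the point \<open>x\<close>.\<close>

lemma eventually_subgradient_with_small_error:
  fixes h :: "'x::lc_space \<Rightarrow> ereal"
  assumes cv: "convex_fun h" and a: "h xbar = ereal a" and cont: "isCont h xbar" and \<delta>: "\<delta> > 0"
  shows "\<forall>\<^sub>F x in nhds xbar. \<exists>b s \<eta>. h x = ereal b \<and> s \<in> subdiff h x \<and>
    \<eta> = a - b + dual_apply s (x - xbar) \<and> 0 \<le> \<eta> \<and> \<eta> \<le> \<delta> \<and> s \<in> eps_subdiff \<eta> h xbar"
proof -
  define r where "r x = real_of_ereal (h x)" for x
  have lim_r: "(r \<longlongrightarrow> a) (nhds xbar)"
    using isCont_imp_tendsto_nhds[OF cont] unfolding r_def a by (rule lim_real_of_ereal)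
  have fin: "\<forall>\<^sub>F x in nhds xbar. h x = ereal (r x) \<and> a - 1 \<le> r x \<and> h x \<le> ereal (a + 1)"
    unfolding r_def using eventually_finite_near[OF cont a] .
  have reflect: "((\<lambda>x. x + (x - xbar)) \<longlongrightarrow> xbar) (nhds xbar)"
    using tendsto_reflection .
  have fin_refl: "\<forall>\<^sub>F x in nhds xbar. h (x + (x - xbar)) = ereal (r (x + (x - xbar)))"
    using eventually_compose_filterlim[OF fin reflect] by (simp add: eventually_conj_iff)
  have "((\<lambda>x. a - r x + (r (x + (x - xbar)) - r x)) \<longlongrightarrow> a - a + (a - a)) (nhds xbar)"
    using reflect by (intro tendsto_intros lim_r filterlim_compose[OF lim_r]) auto
  then have small: "\<forall>\<^sub>F x in nhds xbar. a - r x + (r (x + (x - xbar)) - r x) < \<delta>"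
    using \<delta> order_tendstoD(2)[of _ 0 _ \<delta>] by simp
  have bdd: "\<forall>\<^sub>F x in nhds xbar. \<forall>\<^sub>F y in nhds x. h y \<le> ereal (a + 1)"
    using fin by (simp add: eventually_eventually eventually_conj_iff)
  show ?thesis
    using fin fin_refl small bdd
  proof eventually_elim
    case (elim x)
    have hx: "h x = ereal (r x)" using elim by blast
    obtain s where s: "s \<in> subdiff h x"
      using subdiff_nonempty[OF cv hx elim(4)] by blast
    have s_le: "dual_apply s (y - x) \<le> b - r x" if "h y \<le> ereal b" for y b
      using s that unfolding eps_subdiff_iff[of h x, OF hx] by simp
    define \<eta> where "\<eta> = a - r x + dual_apply s (x - xbar)"
    have "0 \<le> \<eta>"
      using s_le[of xbar a] a by (simp add: \<eta>_def linear_diff[OF linear_dual_apply])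
    moreover have "\<eta> \<le> \<delta>"
      using s_le[of "x + (x - xbar)" "r (x + (x - xbar))"] elim by (simp add: \<eta>_def)
    moreover have "s \<in> eps_subdiff \<eta> h xbar"
      using eps_subdiff_change_point[OF s hx a] by (simp add: \<eta>_def)
    ultimately show ?case using hx s \<eta>_def by blast
  qed
qed

text \<open>The subgradient inequalities of the two summands, taken from \<open>xbar\<close> to \<open>x\<close>, add up to
  \<open>0 \<le> \<alpha>\<^sub>1 (\<phi> x - \<phi> xbar) + \<alpha>\<^sub>2 \<langle>l, \<Phi>(x)\<rangle>\<close>: the value prescribed for the total error cancels the
  rest. This is conclusive unless \<open>\<alpha>\<^sub>1 = 0\<close>, which the absence of common subgradients excludes.\<close>

lemma objective_le_if_subgradient_decomposes:
  fixes h \<phi> :: "'x::lc_space \<Rightarrow> ereal" and \<Phi> :: "'x \<Rightarrow> 'y::lc_space option"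
  assumes a: "h xbar = ereal a" and hx: "h x = ereal b" and s: "s \<in> subdiff h x"
    and v0: "\<Phi> xbar = Some v0" and v: "\<Phi> x = Some v" and v_le: "dual_apply l v \<le> 0"
    and \<phi>_ninf: "\<And>x. \<phi> x \<noteq> - \<infinity>" and \<alpha>: "(\<alpha>\<^sub>1, \<alpha>\<^sub>2) \<in> Delta2"
    and \<eta>': "\<alpha>\<^sub>1 * \<eta>\<^sub>1 + \<alpha>\<^sub>2 * (\<eta>\<^sub>2 - dual_apply l v0) = a - b + dual_apply s (x - xbar)"
    and sum: "s \<in> set_scale \<alpha>\<^sub>1 (eps_subdiff \<eta>\<^sub>1 (\<lambda>x. \<phi> x + h x) xbar)
      + set_scale \<alpha>\<^sub>2 (eps_subdiff \<eta>\<^sub>2 (\<lambda>x. scalarize l \<Phi> x + h x) xbar)"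
    and no_common: "\<not> (scalarize l \<Phi> x = 0 \<and>
      subdiff h x \<inter> subdiff (\<lambda>x. scalarize l \<Phi> x + h x) x \<noteq> {})"
  shows "\<phi> xbar \<le> \<phi> x"
proof -
  let ?f = "\<lambda>l x. scalarize l \<Phi> x + h x"
  obtain u w where u: "u \<in> set_scale \<alpha>\<^sub>1 (eps_subdiff \<eta>\<^sub>1 (\<lambda>x. \<phi> x + h x) xbar)"
    and w: "w \<in> set_scale \<alpha>\<^sub>2 (eps_subdiff \<eta>\<^sub>2 (?f l) xbar)" and suw: "s = u + w"
    using sum by (rule set_plus_elim)
  have \<alpha>s: "\<alpha>\<^sub>1 \<ge> 0" "\<alpha>\<^sub>2 \<ge> 0" "\<alpha>\<^sub>1 + \<alpha>\<^sub>2 = 1" using \<alpha> by (auto simp: Delta2_def)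
  have fxbar: "?f l xbar = ereal (dual_apply l v0 + a)" by (simp add: scalarize_def v0 a)
  have fx: "?f l x = ereal (dual_apply l v + b)" by (simp add: scalarize_def v hx)
  have w_le: "dual_apply w (x - xbar) \<le> \<alpha>\<^sub>2 * (dual_apply l v + b - (dual_apply l v0 + a) + \<eta>\<^sub>2)"
    using set_scale_eps_subdiff_le[OF w \<alpha>s(2) fxbar, of x] fx by simp
  \<comment> \<open>With \<open>\<alpha>\<^sub>1 = 0\<close>, moving \<open>s\<close> back from \<open>xbar\<close> to \<open>x\<close> leaves the error \<open>\<langle>l, \<Phi>(x)\<rangle>\<close>. It is
    nonnegative, hence zero by the assumed sign, so \<open>s\<close> would be a common subgradient at \<open>x\<close>.\<close>
  have \<alpha>1: "\<alpha>\<^sub>1 > 0"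
  proof (rule ccontr)
    assume "\<not> \<alpha>\<^sub>1 > 0"
    with \<alpha>s have [simp]: "\<alpha>\<^sub>1 = 0" "\<alpha>\<^sub>2 = 1" by auto
    have "s \<in> eps_subdiff \<eta>\<^sub>2 (?f l) xbar"
      using u w suw by (auto simp: set_scale_def split: if_splits)
    moreover have "\<eta>\<^sub>2 + (dual_apply l v + b) - (dual_apply l v0 + a) + dual_apply s (xbar - x)
        = dual_apply l v"
      using \<eta>' by (simp add: linear_diff[OF linear_dual_apply])
    ultimately have s0: "s \<in> eps_subdiff (dual_apply l v) (?f l) x"
      using eps_subdiff_change_point[of s \<eta>\<^sub>2 "?f l" xbar, OF _ fxbar fx] by (simp only:)
    then have "dual_apply s (x - x) \<le> (dual_apply l v + b) - (dual_apply l v + b) + dual_apply l v"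
      using eps_subdiff_iff[of "?f l" x, OF fx] eq_refl[OF fx] by blast
    then have "0 \<le> dual_apply l v" by (simp add: linear_0[OF linear_dual_apply])
    with v_le have lv: "dual_apply l v = 0" by simp
    then have "scalarize l \<Phi> x = 0"
      by (simp add: scalarize_def v zero_ereal_def)
    moreover have "s \<in> subdiff h x \<inter> subdiff (?f l) x"
      using s s0 unfolding lv by (rule IntI)
    ultimately show False using no_common by blast
  qed
  show ?thesis
  proof (cases "\<phi> x")
    case (real q)
    have "eps_subdiff \<eta>\<^sub>1 (\<lambda>x. \<phi> x + h x) xbar \<noteq> {}"
      using u \<alpha>1 by (auto simp: set_scale_def)
    then have "\<phi> xbar \<noteq> \<infinity>" by (auto simp: eps_subdiff_def a)
    then obtain q0 where q0: "\<phi> xbar = ereal q0" using \<phi>_ninf[of xbar] by (cases "\<phi> xbar") auto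
    have "dual_apply u (x - xbar) \<le> \<alpha>\<^sub>1 * (q + b - (q0 + a) + \<eta>\<^sub>1)"
      using set_scale_eps_subdiff_le[OF u \<alpha>s(1), of "q0 + a" x "q + b"] by (simp add: q0 a real hx)
    with w_le have "dual_apply s (x - xbar) \<le> \<alpha>\<^sub>1 * (q + b - (q0 + a) + \<eta>\<^sub>1)
        + \<alpha>\<^sub>2 * (dual_apply l v + b - (dual_apply l v0 + a) + \<eta>\<^sub>2)"
      by (simp add: suw)
    also have "\<dots> = \<alpha>\<^sub>1 * (q - q0) + \<alpha>\<^sub>2 * dual_apply l v + (\<alpha>\<^sub>1 + \<alpha>\<^sub>2) * (b - a)
        + (\<alpha>\<^sub>1 * \<eta>\<^sub>1 + \<alpha>\<^sub>2 * (\<eta>\<^sub>2 - dual_apply l v0))"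
      by (simp add: algebra_simps)
    also have "\<dots> = \<alpha>\<^sub>1 * (q - q0) + \<alpha>\<^sub>2 * dual_apply l v + dual_apply s (x - xbar)"
      unfolding \<alpha>s \<eta>' by simp
    finally have "0 \<le> \<alpha>\<^sub>1 * (q - q0) + \<alpha>\<^sub>2 * dual_apply l v" by simp
    also have "\<dots> \<le> \<alpha>\<^sub>1 * (q - q0)"
      using v_le \<alpha>s(2) by (simp add: mult_nonneg_nonpos)
    finally have "q0 \<le> q" using \<alpha>1 by (simp add: zero_le_mult_iff)
    then show ?thesis by (simp add: q0 real)
  next
    case MInf
    then show ?thesis using \<phi>_ninf by blast
  qed simp
qed

theorem theorem4p7:
  fixes K :: "'y::lc_space set" and B :: "'y dual set"
    and \<Phi> :: "'x::lc_space \<Rightarrow> 'y option" and \<phi> h :: "'x \<Rightarrow> ereal" and xbar :: 'x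
  assumes "closed K" and "convex_cone K"
    and "B \<noteq> {}" and "wstar_compactly_generated (positive_polar K) B"
    and "h \<in> Gamma0" and "\<Phi> \<in> Gamma_vec h B" and "\<phi> \<in> Gamma_rel h"
    and "feasible \<Phi> K xbar"
    and "\<exists>\<delta>>0. \<forall>\<eta>::real. 0 \<le> \<eta> \<and> \<eta> \<le> \<delta> \<longrightarrow>
      eps_subdiff \<eta> h xbar \<subseteq>
        \<Union>{set_scale \<alpha>\<^sub>1 (eps_subdiff \<eta>\<^sub>1 (\<lambda>x. \<phi> x + h x) xbar)
            + set_scale \<alpha>\<^sub>2 (eps_subdiff \<eta>\<^sub>2 (\<lambda>x. scalarize l \<Phi> x + h x) xbar)
          | \<eta>\<^sub>1 \<eta>\<^sub>2 \<alpha>\<^sub>1 \<alpha>\<^sub>2 l. 0 \<le> \<eta>\<^sub>1 \<and> 0 \<le> \<eta>\<^sub>2 \<and> (\<alpha>\<^sub>1, \<alpha>\<^sub>2) \<in> Delta2 \<and> l \<in> B \<and>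
              ereal (\<alpha>\<^sub>1 * \<eta>\<^sub>1) + ereal \<alpha>\<^sub>2 * (ereal \<eta>\<^sub>2 - scalarize l \<Phi> xbar) = ereal \<eta>}"
    and "isCont h xbar"
    and "subdiff h xbar \<inter>
      \<Union>{subdiff (\<lambda>x. scalarize l \<Phi> x + h x) xbar | l. l \<in> B \<and> scalarize l \<Phi> xbar = 0} = {}"
  shows "local_solution \<phi> \<Phi> K xbar"
proof -
  have B: "compact B" and B_pos: "B \<subseteq> positive_polar K"
  proof -
    have "B \<subseteq> convex_cone hull B" by (rule hull_subset)
    also have "\<dots> \<subseteq> closure (convex_cone hull B)" by (rule closure_subset)
    finally show "B \<subseteq> positive_polar K"
      using assms(4) by (simp add: wstar_compactly_generated_def)
    show "compact B" using assms(4) by (simp add: wstar_compactly_generated_def)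
  qed
  have feasD: "\<exists>v. \<Phi> x = Some v \<and> (\<forall>l\<in>B. dual_apply l v \<le> 0)" if x: "feasible \<Phi> K x" for x
  proof -
    obtain k where "k \<in> K" "\<Phi> x = Some (- k)" using x by (auto simp: feasible_def)
    then show ?thesis
      using B_pos by (auto simp: positive_polar_def linear_neg[OF linear_dual_apply])
  qed
  obtain v0 where v0: "\<Phi> xbar = Some v0" and v0_le: "\<And>l. l \<in> B \<Longrightarrow> dual_apply l v0 \<le> 0"
    using feasD[OF assms(8)] by blast
  have "h xbar \<noteq> \<infinity>" "h xbar \<noteq> - \<infinity>" and cv: "convex_fun h"
    using assms(5,6) v0 by (auto simp: Gamma_vec_def vdom_def edom_def Gamma0_def)
  then obtain a where a: "h xbar = ereal a" by (cases "h xbar") auto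
  have \<phi>_ninf: "\<phi> x \<noteq> - \<infinity>" for x using assms(7) by (simp add: Gamma_rel_def)
  have good: "\<forall>\<^sub>F x in nhds xbar. \<not> (\<exists>l\<in>B. scalarize l \<Phi> x = 0 \<and>
      subdiff h x \<inter> subdiff (\<lambda>x. scalarize l \<Phi> x + h x) x \<noteq> {})"
    using no_common_subgradients_nearby[where h = h and \<Phi> = \<Phi>, OF B a assms(10) v0 _ assms(11)] v0_le by blast
  let ?U = "\<lambda>\<eta>. \<Union>{set_scale \<alpha>\<^sub>1 (eps_subdiff \<eta>\<^sub>1 (\<lambda>x. \<phi> x + h x) xbar)
        + set_scale \<alpha>\<^sub>2 (eps_subdiff \<eta>\<^sub>2 (\<lambda>x. scalarize l \<Phi> x + h x) xbar)
      | \<eta>\<^sub>1 \<eta>\<^sub>2 \<alpha>\<^sub>1 \<alpha>\<^sub>2 l. 0 \<le> \<eta>\<^sub>1 \<and> 0 \<le> \<eta>\<^sub>2 \<and> (\<alpha>\<^sub>1, \<alpha>\<^sub>2) \<in> Delta2 \<and> l \<in> B \<and>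
          ereal (\<alpha>\<^sub>1 * \<eta>\<^sub>1) + ereal \<alpha>\<^sub>2 * (ereal \<eta>\<^sub>2 - scalarize l \<Phi> xbar) = ereal \<eta>}"
  obtain \<delta> where \<delta>: "\<delta> > 0"
    and incl: "\<forall>\<eta>. 0 \<le> \<eta> \<and> \<eta> \<le> \<delta> \<longrightarrow> eps_subdiff \<eta> h xbar \<subseteq> ?U \<eta>"
    using assms(9) by (elim exE conjE) (rule that)

  have "\<forall>\<^sub>F x in nhds xbar. feasible \<Phi> K x \<longrightarrow> \<phi> xbar \<le> \<phi> x"
    using eventually_subgradient_with_small_error[OF cv a assms(10) \<delta>] good
  proof eventually_elim
    case (elim x)
    show ?case
    proof
      assume "feasible \<Phi> K x"
      then obtain v where v: "\<Phi> x = Some v" and v_le: "\<And>l. l \<in> B \<Longrightarrow> dual_apply l v \<le> 0"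
        using feasD by blast
      obtain b s \<eta> where hx: "h x = ereal b" and s: "s \<in> subdiff h x"
        and \<eta>_def: "\<eta> = a - b + dual_apply s (x - xbar)"
        and \<eta>_bounds: "0 \<le> \<eta>" "\<eta> \<le> \<delta>" and s_eps: "s \<in> eps_subdiff \<eta> h xbar"
        using elim(1) by blast
      from incl \<eta>_bounds have "eps_subdiff \<eta> h xbar \<subseteq> ?U \<eta>" by (simp only: simp_thms)
      then have "s \<in> ?U \<eta>" using s_eps by (rule subsetD)
      then obtain \<eta>\<^sub>1 \<eta>\<^sub>2 \<alpha>\<^sub>1 \<alpha>\<^sub>2 l where \<alpha>: "(\<alpha>\<^sub>1, \<alpha>\<^sub>2) \<in> Delta2" and l: "l \<in> B"
        and \<eta>: "ereal (\<alpha>\<^sub>1 * \<eta>\<^sub>1) + ereal \<alpha>\<^sub>2 * (ereal \<eta>\<^sub>2 - scalarize l \<Phi> xbar) = ereal \<eta>"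
        and sum: "s \<in> set_scale \<alpha>\<^sub>1 (eps_subdiff \<eta>\<^sub>1 (\<lambda>x. \<phi> x + h x) xbar)
          + set_scale \<alpha>\<^sub>2 (eps_subdiff \<eta>\<^sub>2 (\<lambda>x. scalarize l \<Phi> x + h x) xbar)"
        by blast
      have \<eta>': "\<alpha>\<^sub>1 * \<eta>\<^sub>1 + \<alpha>\<^sub>2 * (\<eta>\<^sub>2 - dual_apply l v0) = a - b + dual_apply s (x - xbar)"
        using \<eta> by (simp add: scalarize_def v0 \<eta>_def)
      have "\<not> (scalarize l \<Phi> x = 0 \<and> subdiff h x \<inter> subdiff (\<lambda>x. scalarize l \<Phi> x + h x) x \<noteq> {})"
        using elim(2) l by blast
      then show "\<phi> xbar \<le> \<phi> x"
        by (rule objective_le_if_subgradient_decomposes[where h = h and \<phi> = \<phi> and \<Phi> = \<Phi>,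
              OF a hx s v0 v v_le[OF l] \<phi>_ninf \<alpha> \<eta>' sum])
    qed
  qed
  then show ?thesis
    using assms(8) unfolding local_solution_def eventually_nhds by (intro conjI)
qed

end
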